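(* Let $G$ be a finite simple graph that contains no subdivision of $K_5$ as a subgraph. Then $\tau(G) \leq 2\nu(G)$.
   Context: $\nu(G)$ is the maximum number of pairwise edge-disjoint triangles in $G$. $\tau(G)$ is the minimum size of an edge set $Y \subseteq E(G)$ such that $G - Y$ is triangle-free. *)

theory Defs
  imports Main
begin

definition simple_graph :: "'a set \<Rightarrow> 'a set set \<Rightarrow> bool" where
  "simple_graph V E \<longleftrightarrow> finite V \<and>
     (\<forall>e\<in>E. \<exists>u v. u \<noteq> v \<and> u \<in> V \<and> v \<in> V \<and> e = {u, v})"

definition triangles :: "'a set set \<Rightarrow> 'a set set set" where
  "triangles E = {{{a, b}, {b, c}, {a, c}} | a b c.
      a \<noteq> b \<and> b \<noteq> c \<and> a \<noteq> c \<and> {a, b} \<in> E \<and> {b, c} \<in> E \<and> {a, c} \<in> E}"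

definition triangle_packing_number :: "'a set set \<Rightarrow> nat" where
  "triangle_packing_number E =
     Max (card ` {T. T \<subseteq> triangles E \<and> pairwise (\<lambda>s t. s \<inter> t = {}) T})"

definition triangle_cover_number :: "'a set set \<Rightarrow> nat" where
  "triangle_cover_number E =
     Min (card ` {Y. Y \<subseteq> E \<and> triangles (E - Y) = {}})"

definition is_path :: "'a set set \<Rightarrow> 'a list \<Rightarrow> bool" where
  "is_path E p \<longleftrightarrow> distinct p \<and> length p \<ge> 2 \<and>
     (\<forall>i. Suc i < length p \<longrightarrow> {p ! i, p ! Suc i} \<in> E)"

definition interior :: "'a list \<Rightarrow> 'a set" where
  "interior p = set (butlast (tl p))"

definition has_K5_subdivision :: "'a set \<Rightarrow> 'a set set \<Rightarrow> bool" where
  "has_K5_subdivision V E \<longleftrightarrow>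
     (\<exists>(b :: nat \<Rightarrow> 'a) (P :: nat \<Rightarrow> nat \<Rightarrow> 'a list).
        inj_on b {0..<5} \<and> b ` {0..<5} \<subseteq> V \<and>
        (\<forall>i j. i < j \<and> j < 5 \<longrightarrow>
            is_path E (P i j) \<and> hd (P i j) = b i \<and> last (P i j) = b j \<and>
            interior (P i j) \<inter> b ` {0..<5} = {}) \<and>
        (\<forall>i j k l. i < j \<and> j < 5 \<and> k < l \<and> l < 5 \<and> (i, j) \<noteq> (k, l) \<longrightarrow>
            interior (P i j) \<inter> interior (P k l) = {}))"

end

theory Submission
  imports Defs
begin

text \<open>Call the link of a vertex \<open>v\<close> the graph formed by the edges that span a triangle with \<open>v\<close>. If the
  link has a matching \<open>M\<close> and a vertex cover \<open>C\<close> of the link minus \<open>M\<close> with \<open>|C| \<le> |M|\<close>, then packing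
  the \<open>|M|\<close> triangles over \<open>M\<close> and deleting the edges of \<open>M\<close> together with the edges from \<open>v\<close> to \<open>C\<close>
  destroys every triangle that shares an edge with the packed ones, at a price of at most \<open>2|M|\<close>,
  so induction applies. A graph without a \<open>K\<^sub>5\<close>-subdivision has links without
  \<open>K\<^sub>4\<close>-subdivisions, and each such link has \<open>M\<close> and \<open>C\<close> as required: by Dirac it has a vertex of
  degree at most 2, and series-parallel reduction at that vertex preserves a suitable labelled
  version of the claim.\<close>

section \<open>Matchings and covers in labelled graphs\<close>

text \<open>Balancedness describes partially reduced graphs. An edge labelled \<open>Odd\<close> or \<open>Even\<close> stands for a
  series-parallel piece between its ends that behaves like a path of that parity (length at least 3
  in the odd case), while \<open>Plain\<close> edges are genuine. \<open>C\<close> is the cover, and \<open>g x\<close> is the only edge that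
  may use \<open>x\<close> for the matching. A vertex of \<open>W\<close> is forced into \<open>C\<close> and is paid for when it is not
  needed elsewhere, which is recorded by \<open>g w = {w}\<close>; the value \<open>{}\<close> marks a vertex that is not used
  at all.\<close>

datatype label = Plain | Odd | Even

fun edge_ok :: "label \<Rightarrow> 'a set \<Rightarrow> ('a \<Rightarrow> 'a set) \<Rightarrow> 'a set \<Rightarrow> bool" where
  "edge_ok Plain C g f \<longleftrightarrow> f \<inter> C \<noteq> {} \<or> (\<forall>x\<in>f. g x = f)"
| "edge_ok Odd C g f \<longleftrightarrow> f \<subseteq> C \<or> (\<forall>x\<in>f. g x = f)"
| "edge_ok Even C g f \<longleftrightarrow> f \<inter> C \<noteq> {} \<and> (\<forall>x\<in>f. x \<in> C \<or> g x = f)"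

fun bonus :: "label \<Rightarrow> ('a \<Rightarrow> 'a set) \<Rightarrow> 'a set \<Rightarrow> bool" where
  "bonus Plain g f \<longleftrightarrow> (\<forall>x\<in>f. g x = f)"
| "bonus Odd g f \<longleftrightarrow> True"
| "bonus Even g f \<longleftrightarrow> (\<exists>x\<in>f. g x = f)"

definition gain :: "'a set set \<Rightarrow> ('a set \<Rightarrow> label) \<Rightarrow> ('a \<Rightarrow> 'a set) \<Rightarrow> nat" where
  "gain F lab g = (\<Sum>f\<in>F. of_bool (bonus (lab f) g f))"

definition balanced :: "'a set set \<Rightarrow> ('a set \<Rightarrow> label) \<Rightarrow> 'a set \<Rightarrow> bool" where
  "balanced F lab W \<longleftrightarrow> (\<exists>C g. W \<subseteq> C \<and> C \<subseteq> \<Union>F \<union> W \<and> (\<forall>f\<in>F. edge_ok (lab f) C g f) \<and>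
     card C \<le> gain F lab g + card {w\<in>W. g w = {w}})"

section \<open>Local exchanges as Boolean case checks\<close>

text \<open>\<open>sa\<close> and \<open>sb\<close> record whether the ends lie in the cover,
  \<open>ma\<close> and \<open>mb\<close> whether they are marked for the edge. In this form the
  local exchanges become finite case checks.\<close>

fun okb :: "label \<Rightarrow> bool \<Rightarrow> bool \<Rightarrow> bool \<Rightarrow> bool \<Rightarrow> bool" where
  "okb Plain sa ma sb mb \<longleftrightarrow> sa \<or> sb \<or> ma \<and> mb"
| "okb Odd sa ma sb mb \<longleftrightarrow> sa \<and> sb \<or> ma \<and> mb"
| "okb Even sa ma sb mb \<longleftrightarrow> (sa \<or> sb) \<and> (sa \<or> ma) \<and> (sb \<or> mb)"

fun bonusb :: "label \<Rightarrow> bool \<Rightarrow> bool \<Rightarrow> bool" where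
  "bonusb Plain ma mb \<longleftrightarrow> ma \<and> mb"
| "bonusb Odd ma mb \<longleftrightarrow> True"
| "bonusb Even ma mb \<longleftrightarrow> ma \<or> mb"

lemma edge_ok_doubleton:
  "edge_ok l C g {a, b} \<longleftrightarrow> okb l (a \<in> C) (g a = {a, b}) (b \<in> C) (g b = {a, b})"
  by (cases l) auto

lemma bonus_doubleton: "bonus l g {a, b} \<longleftrightarrow> bonusb l (g a = {a, b}) (g b = {a, b})"
  by (cases l) auto

text \<open>Series composition adds parities. In parallel, a plain edge is absorbed by an even piece; every
  other pair of parallel pieces allows both ends to be forced into the cover.\<close>

definition series :: "label \<Rightarrow> label \<Rightarrow> label" where
  "series l1 l2 = (if (l1 = Even) = (l2 = Even) then Even else Odd)"

text \<open>Expands a composed edge between a and b through a new vertex u. \<open>su\<close> puts u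
  into the cover at cost one, \<open>q1\<close> and \<open>q2\<close> spend the only mark of u, and
  \<open>p\<close> and \<open>r\<close> reuse the marks that the composed edge held at a and b. The
  bonuses of the two pieces pay for u and for the lost bonus.\<close>

lemma series_bits:
  assumes "okb (series l1 l2) sa ma sb mb"
  shows "\<exists>su p q1 q2 r. \<not> (q1 \<and> q2) \<and> (p \<longrightarrow> ma) \<and> (r \<longrightarrow> mb) \<and>
     okb l1 su q1 sa p \<and> okb l2 su q2 sb r \<and>
     of_bool su + of_bool (bonusb (series l1 l2) ma mb)
       \<le> (of_bool (bonusb l1 q1 p) + of_bool (bonusb l2 q2 r) :: nat)"
  using assms unfolding series_def
  by (cases l1; cases l2; cases sa; cases sb; cases ma; cases mb; simp add: ex_bool_eq)

text \<open>Both ends are in the cover, and \<open>ma\<close>, \<open>mb\<close> tell which of them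
  carry a payment that must be returned. A paid end may instead be marked for one of its two edges.
  The excluded combination really fails: a triangle of plain edges has only one matching edge for
  two payments.\<close>

lemma merge_bits:
  assumes "l \<noteq> Plain \<or> series l1 l2 \<noteq> Even"
  shows "\<exists>su p q1 q2 r pa ra. \<not> (q1 \<and> q2) \<and> \<not> (p \<and> pa) \<and> \<not> (r \<and> ra) \<and>
     (p \<or> pa \<longrightarrow> ma) \<and> (r \<or> ra \<longrightarrow> mb) \<and>
     okb l1 su q1 True p \<and> okb l2 su q2 True r \<and>
     of_bool su + of_bool ma + of_bool mb
       \<le> (of_bool (bonusb l1 q1 p) + of_bool (bonusb l2 q2 r) + of_bool (bonusb l pa ra) :: nat)"
  using assms unfolding series_def
  by (cases l; cases l1; cases l2; cases ma; cases mb; simp add: ex_bool_eq)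

text \<open>The same accounting for a pendant edge: \<open>su\<close> and \<open>q\<close> belong to
  the leaf, while the inner end is in the cover.\<close>

lemma leaf_bits:
  "\<exists>su p q. (p \<longrightarrow> ma) \<and> okb l su q True p \<and> of_bool su + of_bool ma \<le> (of_bool (bonusb l q p) :: nat)"
  by (cases l; cases ma; simp add: ex_bool_eq)

section \<open>Reduction steps for balancedness\<close>

lemma edge_ok_cong:
  assumes "\<And>x. x \<in> f \<Longrightarrow> x \<in> C \<longleftrightarrow> x \<in> C'" "\<And>x. x \<in> f \<Longrightarrow> g x = f \<longleftrightarrow> g' x = f"
  shows "edge_ok l C g f = edge_ok l C' g' f"
  using assms by (cases l) (auto simp: disjoint_iff subset_iff)

lemma bonus_cong:
  assumes "\<And>x. x \<in> f \<Longrightarrow> g x = f \<longleftrightarrow> g' x = f"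
  shows "bonus l g f = bonus l g' f"
  using assms by (cases l) auto

lemma gain_cong:
  assumes "\<And>f x. f \<in> F \<Longrightarrow> x \<in> f \<Longrightarrow> g x = f \<longleftrightarrow> g' x = f" "\<And>f. f \<in> F \<Longrightarrow> lab f = lab' f"
  shows "gain F lab g = gain F lab' g'"
  unfolding gain_def using assms bonus_cong[of _ g g'] by (intro sum.cong) auto

lemma gain_empty: "gain {} lab g = 0"
  by (simp add: gain_def)

lemma gain_insert:
  "finite F \<Longrightarrow> f \<notin> F \<Longrightarrow> gain (insert f F) lab g = of_bool (bonus (lab f) g f) + gain F lab g"
  by (simp add: gain_def del: sum_of_bool_eq)

lemma gain_Un:
  assumes "finite F" "finite A" "F \<inter> A = {}"
  shows "gain (F \<union> A) lab g = gain F lab g + gain A lab g"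
  unfolding gain_def using assms by (rule sum.union_disjoint)

text \<open>Frame rule for all reductions: \<open>A'\<close> is exchanged for \<open>A\<close>,
  while the edges of \<open>F0\<close> see the same cover and the same marks. They keep their
  conditions and their gain, so only \<open>A\<close> and the difference in cost remain to be
  checked.\<close>

lemma balanced_transfer:
  assumes fin: "finite F0" "finite A" "finite A'" and disj: "F0 \<inter> A = {}" "F0 \<inter> A' = {}"
    and lab: "\<And>f. f \<in> F0 \<Longrightarrow> lab f = lab' f"
    and ok: "\<And>f. f \<in> F0 \<union> A' \<Longrightarrow> edge_ok (lab' f) C g f"
    and card: "card C \<le> gain (F0 \<union> A') lab' g + card {w\<in>W'. g w = {w}}"
    and C_eq: "\<And>f x. f \<in> F0 \<Longrightarrow> x \<in> f \<Longrightarrow> x \<in> C \<longleftrightarrow> x \<in> C'"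
    and g_eq: "\<And>f x. f \<in> F0 \<Longrightarrow> x \<in> f \<Longrightarrow> g x = f \<longleftrightarrow> g' x = f"
    and C': "W \<subseteq> C'" "C' \<subseteq> \<Union>(F0 \<union> A) \<union> W"
    and okA: "\<And>f. f \<in> A \<Longrightarrow> edge_ok (lab f) C' g' f"
    and le: "card C' + gain A' lab' g + card {w\<in>W'. g w = {w}}
               \<le> card C + gain A lab g' + card {w\<in>W. g' w = {w}}"
  shows "balanced (F0 \<union> A) lab W"
proof -
  have "gain F0 lab' g = gain F0 lab g'"
    using g_eq lab by (intro gain_cong) auto
  then have "card C' \<le> gain (F0 \<union> A) lab g' + card {w\<in>W. g' w = {w}}"
    using card le fin disj by (simp add: gain_Un)
  moreover have "edge_ok (lab f) C' g' f" if "f \<in> F0 \<union> A" for f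
  proof (cases "f \<in> A")
    case False
    then have "f \<in> F0" using that by blast
    then show ?thesis using ok[of f] lab edge_ok_cong[of f C C' g g' "lab f"] C_eq g_eq by auto
  qed (use okA in auto)
  ultimately show ?thesis
    unfolding balanced_def using C' by blast
qed

text \<open>The forced vertices alone satisfy the edge, so it returns with the same \<open>C\<close>
  and \<open>g\<close>, and its bonus can only help.\<close>

lemma balanced_forced_edge:
  assumes fin: "finite F" and f: "f \<in> F" "f \<subseteq> W \<or> lab f = Plain \<and> f \<inter> W \<noteq> {}" "f \<noteq> {}"
    and bal: "balanced (F - {f}) lab W"
  shows "balanced F lab W"
proof -
  obtain C g where C: "W \<subseteq> C" "C \<subseteq> \<Union>(F - {f}) \<union> W" "\<forall>f\<in>F - {f}. edge_ok (lab f) C g f"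
    "card C \<le> gain (F - {f}) lab g + card {w\<in>W. g w = {w}}"
    using bal unfolding balanced_def by blast
  have "edge_ok (lab f) C g f" using f C(1) by (cases "lab f") auto
  moreover have "gain (F - {f}) lab g \<le> gain F lab g"
    unfolding gain_def by (rule sum_mono2) (use fin in auto)
  ultimately show ?thesis unfolding balanced_def using C by (intro exI[of _ C] exI[of _ g]) auto
qed

lemma marks_insert:
  assumes "finite W" "a \<notin> W"
  shows "card {w\<in>insert a W. g w = {w}} = card {w\<in>W. g w = {w}} + of_bool (g a = {a})"
proof -
  have "{w\<in>insert a W. g w = {w}} = (if g a = {a} then insert a {w\<in>W. g w = {w}} else {w\<in>W. g w = {w}})"
    by auto
  then show ?thesis using assms by auto
qed

text \<open>A composed edge with one forced end lets the other end be forced too: a payment recorded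
  at \<open>b\<close> is turned into a mark for the edge, whose bonus replaces it.\<close>

lemma balanced_spread:
  assumes fin: "finite F" "finite W" and f: "{w, b} \<in> F" "w \<in> W" "b \<notin> W" "lab {w, b} \<noteq> Plain"
    and two: "\<forall>f\<in>F. card f = 2"
    and bal: "balanced (F - {{w, b}}) lab (insert b W)"
  shows "balanced F lab W"
proof -
  let ?f = "{w, b}" and ?F = "F - {{w, b}}"
  obtain C g where C: "insert b W \<subseteq> C" "C \<subseteq> \<Union>?F \<union> insert b W" "\<forall>f\<in>?F. edge_ok (lab f) C g f"
    "card C \<le> gain ?F lab g + card {x\<in>insert b W. g x = {x}}"
    using bal unfolding balanced_def by blast
  define g' where "g' = (if g b = {b} then g(b := ?f) else g)"
  have ne: "w \<noteq> b" using f by auto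
  have "balanced (?F \<union> {?f}) lab W"
  proof (rule balanced_transfer[where C = C and C' = C and A' = "{}" and lab' = lab and W' = "insert b W"
        and g = g and g' = g'])
    show "g x = f \<longleftrightarrow> g' x = f" if "f \<in> ?F" "x \<in> f" for f x
    proof -
      \<comment> \<open>Edges have two elements, so they are never confused with the payment value
        \<open>{b}\<close>.\<close>
      have "f \<noteq> {b}" using two that by auto
      then show ?thesis using that unfolding g'_def by auto
    qed
    show "edge_ok (lab f) C g' f" if "f \<in> {?f}" for f
      using that f(4) C(1) f(2) by (cases "lab f") auto
    have "{x\<in>W. g' x = {x}} = {x\<in>W. g x = {x}}"
      using f(3) unfolding g'_def by auto
    moreover have "of_bool (g b = {b}) \<le> gain {?f} lab g'"
      using f(4) unfolding gain_def g'_def by (cases "lab ?f") auto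
    ultimately show "card C + gain {} lab g + card {w \<in> insert b W. g w = {w}}
         \<le> card C + gain {?f} lab g' + card {w \<in> W. g' w = {w}}"
      unfolding marks_insert[OF fin(2) f(3)] by (simp add: gain_empty)
  qed (use fin C f in auto)
  then show ?thesis using f(1) by (simp add: insert_absorb)
qed

lemma finite_Union_edges:
  assumes "finite F" "\<forall>f\<in>F. card f = 2"
  shows "finite (\<Union>F)"
  using assms by (intro finite_Union) (auto intro: card_ge_0_finite)

text \<open>The inner end \<open>a\<close> is forced into the cover of the smaller graph, and the
  bonus of the pendant edge pays for \<open>a\<close>, and for the leaf if it has to join the
  cover.\<close>

lemma balanced_leaf:
  assumes fin: "finite F" "finite W" and f: "{u, a} \<in> F" "u \<noteq> a" "a \<notin> W" "u \<notin> W"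
    and u: "u \<notin> \<Union>(F - {{u, a}})"
    and two: "\<forall>f\<in>F. card f = 2"
    and bal: "balanced (F - {{u, a}}) lab (insert a W)"
  shows "balanced F lab W"
proof -
  let ?f = "{u, a}" and ?F = "F - {{u, a}}"
  obtain C g where C: "insert a W \<subseteq> C" "C \<subseteq> \<Union>?F \<union> insert a W" "\<forall>f\<in>?F. edge_ok (lab f) C g f"
    "card C \<le> gain ?F lab g + card {x\<in>insert a W. g x = {x}}"
    using bal unfolding balanced_def by blast
  have "finite (\<Union>?F)" using fin two by (intro finite_Union_edges) auto
  then have finC: "finite C" using C(2) fin by (meson finite.insertI finite_UnI finite_subset)
  have uC: "u \<notin> C" using C(2) u f by auto
  obtain su p q where bits: "p \<longrightarrow> g a = {a}" "okb (lab ?f) su q True p"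
    "of_bool su + of_bool (g a = {a}) \<le> (of_bool (bonusb (lab ?f) q p) :: nat)"
    using leaf_bits[of "g a = {a}" "lab ?f"] by blast
  define C' where "C' = (if su then insert u C else C)"
  \<comment> \<open>A stale value at \<open>a\<close> is erased, so that \<open>a\<close> is marked
    for the pendant edge exactly if \<open>p\<close> holds.\<close>
  define g' where "g' = g(u := if q then ?f else {}, a := if p then ?f else if g a = {a} then {} else if g a = ?f then {} else g a)"
  have g': "g' u = ?f \<longleftrightarrow> q" "g' a = ?f \<longleftrightarrow> p" using f(2) unfolding g'_def by auto
  have "balanced (?F \<union> {?f}) lab W"
  proof (rule balanced_transfer[where C = C and C' = C' and A' = "{}" and lab' = lab and W' = "insert a W"
        and g = g and g' = g'])
    show "g x = f' \<longleftrightarrow> g' x = f'" if "f' \<in> ?F" "x \<in> f'" for f' x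
    proof -
      have "f' \<noteq> {a}" "f' \<noteq> {}" using two that by auto
      moreover have "x \<noteq> u" using u that by auto
      ultimately show ?thesis using that bits(1) unfolding g'_def by auto
    qed
    show "x \<in> C \<longleftrightarrow> x \<in> C'" if "f' \<in> ?F" "x \<in> f'" for f' x
      using u that unfolding C'_def by auto
    show "edge_ok (lab f') C' g' f'" if "f' \<in> {?f}" for f'
    proof -
      have "u \<in> C' \<longleftrightarrow> su" "a \<in> C'" using uC C(1) by (auto simp: C'_def)
      then show ?thesis using that g' bits(2) by (simp add: edge_ok_doubleton)
    qed
    have "{x\<in>W. g' x = {x}} = {x\<in>W. g x = {x}}"
      using f unfolding g'_def by auto
    moreover have "of_bool su + of_bool (g a = {a}) \<le> gain {?f} lab g'"
      using bits(3) g' by (simp add: gain_insert gain_empty bonus_doubleton)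
    moreover have "card C' = card C + of_bool su" using finC uC by (simp add: C'_def)
    ultimately show "card C' + gain {} lab g + card {w \<in> insert a W. g w = {w}}
         \<le> card C + gain {?f} lab g' + card {w \<in> W. g' w = {w}}"
      unfolding marks_insert[OF fin(2) f(3)] by (simp add: gain_empty)
  qed (use fin C f in \<open>auto simp: C'_def\<close>)
  then show ?thesis using f(1) by (simp add: insert_absorb)
qed

text \<open>\<open>v\<close> is the old mark of a vertex and \<open>k\<close> the value released by
  the reduction. Only a released mark is reused for \<open>x\<close> or \<open>y\<close>, so no
  other edge \<open>f\<close> loses or gains one.\<close>

lemma reassign_eq_iff:
  assumes "p \<or> q \<longrightarrow> v = k" "f \<noteq> k" "f \<noteq> x" "f \<noteq> y" "f \<noteq> {}"
  shows "v = f \<longleftrightarrow> (if p then x else if q then y else if v \<in> {k, x, y} then {} else v) = f"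
  using assms by auto

text \<open>Common core of the two reductions at a vertex \<open>u\<close> with neighbours
  \<open>a\<close> and \<open>b\<close>. The values \<open>ka\<close> and \<open>kb\<close> are what
  the reduced graph releases there: the mark of a composed edge, or the payments \<open>{a}\<close>
  and \<open>{b}\<close> of forced vertices.\<close>

lemma series_exchange:
  assumes fin: "finite F0" "finite W" and two: "\<forall>f\<in>F0. card f = 2"
    and u: "u \<notin> \<Union>F0" and h: "{a, b} \<notin> F0" and ne: "u \<noteq> a" "u \<noteq> b" "a \<noteq> b"
    and W: "u \<notin> W" "a \<notin> W" "b \<notin> W" "W \<subseteq> W'" "W' \<subseteq> W \<union> {a, b}"
    and A: "A \<subseteq> {{a, b}}" "A' \<subseteq> {{a, b}}"
    and lab: "\<And>f. f \<in> F0 \<Longrightarrow> lab f = lab' f"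
    and C: "W' \<subseteq> C" "C \<subseteq> \<Union>(F0 \<union> A') \<union> W'"
    and ok: "\<forall>f\<in>F0 \<union> A'. edge_ok (lab' f) C g f"
    and card: "card C \<le> gain (F0 \<union> A') lab' g + card {w\<in>W'. g w = {w}}"
    and k: "ka = {a} \<or> ka = {a, b}" "kb = {b} \<or> kb = {a, b}"
    and bits: "\<not> (q1 \<and> q2)" "\<not> (p \<and> pa)" "\<not> (r \<and> ra)"
      "p \<or> pa \<longrightarrow> g a = ka" "r \<or> ra \<longrightarrow> g b = kb"
    and okb: "okb (lab {u, a}) su q1 (a \<in> C) p" "okb (lab {u, b}) su q2 (b \<in> C) r"
      "{a, b} \<in> A \<Longrightarrow> okb (lab {a, b}) (a \<in> C) pa (b \<in> C) ra"
    and le: "of_bool su + gain A' lab' g + card {w\<in>W'. g w = {w}}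
       \<le> of_bool (bonusb (lab {u, a}) q1 p) + of_bool (bonusb (lab {u, b}) q2 r)
         + of_bool ({a, b} \<in> A \<and> bonusb (lab {a, b}) pa ra) + card {w\<in>W. g w = {w}}"
  shows "balanced (F0 \<union> ({{u, a}, {u, b}} \<union> A)) lab W"
proof -
  let ?h = "{a, b}" and ?f1 = "{u, a}" and ?f2 = "{u, b}"
  have distinct_edges: "?f1 \<noteq> ?h" "?f2 \<noteq> ?h" "?f1 \<noteq> ?f2"
    using ne by (auto simp: doubleton_eq_iff)
  have f12: "?f1 \<notin> F0" "?f2 \<notin> F0" using u by auto
  have "finite (\<Union>(F0 \<union> A') \<union> W')"
    using finite_Union_edges[OF fin(1) two] W A fin finite_subset[of W' "W \<union> {a, b}"]
      finite_subset[of "\<Union>A'" "{a, b}"] by auto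
  then have finC: "finite C" using C(2) finite_subset by blast
  have uC: "u \<notin> C" using C(2) u W A ne by auto
  define C' where "C' = (if su then insert u C else C)"
  define g' where "g' = g(u := if q1 then ?f1 else if q2 then ?f2 else {},
     a := if p then ?f1 else if pa then ?h else if g a \<in> {ka, ?f1, ?h} then {} else g a,
     b := if r then ?f2 else if ra then ?h else if g b \<in> {kb, ?f2, ?h} then {} else g b)"
  have g': "g' u = ?f1 \<longleftrightarrow> q1" "g' u = ?f2 \<longleftrightarrow> q2" "g' a = ?f1 \<longleftrightarrow> p" "g' b = ?f2 \<longleftrightarrow> r"
    "g' a = ?h \<longleftrightarrow> pa" "g' b = ?h \<longleftrightarrow> ra"
    using ne distinct_edges bits(1-3) unfolding g'_def by auto
  have g_other: "g' x = g x" if "x \<noteq> a" "x \<noteq> b" "x \<noteq> u" for x using that by (simp add: g'_def)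
  have C': "u \<in> C' \<longleftrightarrow> su" "a \<in> C' \<longleftrightarrow> a \<in> C" "b \<in> C' \<longleftrightarrow> b \<in> C"
    using uC ne by (auto simp: C'_def)
  show ?thesis
  proof (rule balanced_transfer[where C = C and C' = C' and A' = A' and lab' = lab' and W' = W'
        and g = g and g' = g'])
    show "g x = f \<longleftrightarrow> g' x = f" if "f \<in> F0" "x \<in> f" for f x
    proof -
      have "f \<noteq> {a}" "f \<noteq> {b}" "f \<noteq> {}" using two that by auto
      moreover have "x \<noteq> u" "f \<noteq> ?h" "f \<noteq> ?f1" "f \<noteq> ?f2" using u h f12 that by auto
      ultimately have "g a = f \<longleftrightarrow> g' a = f" "g b = f \<longleftrightarrow> g' b = f" "x \<noteq> u"
        using ne(3) k reassign_eq_iff[OF bits(4), of f ?f1 ?h] reassign_eq_iff[OF bits(5), of f ?f2 ?h]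
        unfolding g'_def by (simp_all only: fun_upd_apply if_False if_True refl) metis+
      then show ?thesis using g_other by metis
    qed
    show "x \<in> C \<longleftrightarrow> x \<in> C'" if "f \<in> F0" "x \<in> f" for f x
      using u that unfolding C'_def by auto
    show "edge_ok (lab f) C' g' f" if f: "f \<in> {?f1, ?f2} \<union> A" for f
    proof -
      consider "f = ?f1" | "f = ?f2" | "f = ?h" "?h \<in> A" using f A by auto
      then show ?thesis by cases (use okb g' C' in \<open>simp_all add: edge_ok_doubleton\<close>)
    qed
    have "g' x = g x" if "x \<in> W" for x using W that by (metis g_other)
    then have "{x\<in>W. g' x = {x}} = {x\<in>W. g x = {x}}" by auto
    moreover have "gain ({?f1, ?f2} \<union> A) lab g' = of_bool (bonusb (lab ?f1) q1 p)
       + of_bool (bonusb (lab ?f2) q2 r) + of_bool (?h \<in> A \<and> bonusb (lab ?h) pa ra)"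
    proof -
      consider "A = {}" | "A = {?h}" using A by auto
      then show ?thesis
        by cases (use distinct_edges g' in \<open>simp_all add: gain_insert gain_empty bonus_doubleton\<close>)
    qed
    moreover have "card C' = card C + of_bool su" using finC uC by (simp add: C'_def)
    ultimately show "card C' + gain A' lab' g + card {w \<in> W'. g w = {w}}
         \<le> card C + gain ({?f1, ?f2} \<union> A) lab g' + card {w \<in> W. g' w = {w}}"
      using le by simp
    show "finite ({?f1, ?f2} \<union> A)" "finite A'" using A by (auto intro: finite_subset)
    show "F0 \<inter> ({?f1, ?f2} \<union> A) = {}" "F0 \<inter> A' = {}" using A h f12 by auto
    show "W \<subseteq> C'" using W C by (auto simp: C'_def)
    have "C \<subseteq> \<Union>F0 \<union> {a, b} \<union> W" using C(2) W A by auto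
    then show "C' \<subseteq> \<Union>(F0 \<union> ({?f1, ?f2} \<union> A)) \<union> W" by (auto simp: C'_def)
    show "edge_ok (lab' f) C g f" if "f \<in> F0 \<union> A'" for f using ok that by blast
  qed (use fin lab card in auto)
qed


text \<open>\<open>series_bits\<close> undoes the suppression of \<open>u\<close>. A plain edge in
  \<open>A\<close> is covered for free, since an even composed edge has an end in the cover; hence
  \<open>pa\<close> and \<open>ra\<close> are \<open>False\<close>.\<close>

lemma balanced_series:
  assumes fin: "finite F0" "finite W" and two: "\<forall>f\<in>F0. card f = 2"
    and u: "u \<notin> \<Union>F0" and h: "{a, b} \<notin> F0" and ne: "u \<noteq> a" "u \<noteq> b" "a \<noteq> b"
    and W: "u \<notin> W" "a \<notin> W" "b \<notin> W" and A: "A \<subseteq> {{a, b}}"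
    and plain: "A = {} \<or> lab {a, b} = Plain \<and> series (lab {u, a}) (lab {u, b}) = Even"
    and bal: "balanced (insert {a, b} F0) (lab({a, b} := series (lab {u, a}) (lab {u, b}))) W"
  shows "balanced (F0 \<union> ({{u, a}, {u, b}} \<union> A)) lab W"
proof -
  let ?h = "{a, b}" let ?s = "series (lab {u, a}) (lab {u, b})" let ?lab = "lab(?h := ?s)"
  obtain C g where C: "W \<subseteq> C" "C \<subseteq> \<Union>(insert ?h F0) \<union> W" "\<forall>f\<in>insert ?h F0. edge_ok (?lab f) C g f"
    "card C \<le> gain (insert ?h F0) ?lab g + card {w\<in>W. g w = {w}}"
    using bal unfolding balanced_def by blast
  have ok: "okb ?s (a \<in> C) (g a = ?h) (b \<in> C) (g b = ?h)"
    using C(3) by (simp add: edge_ok_doubleton)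
  obtain su p q1 q2 r where bits: "\<not> (q1 \<and> q2)" "p \<longrightarrow> g a = ?h" "r \<longrightarrow> g b = ?h"
    "okb (lab {u, a}) su q1 (a \<in> C) p" "okb (lab {u, b}) su q2 (b \<in> C) r"
    "of_bool su + of_bool (bonusb ?s (g a = ?h) (g b = ?h))
       \<le> (of_bool (bonusb (lab {u, a}) q1 p) + of_bool (bonusb (lab {u, b}) q2 r) :: nat)"
    using series_bits[OF ok] by (elim exE conjE) (rule that)
  show ?thesis
  proof (rule series_exchange[where C = C and g = g and A' = "{?h}" and lab' = ?lab and W' = W
        and ka = ?h and kb = ?h and pa = False and ra = False and p = p and r = r
        and su = su and ?q1.0 = q1 and ?q2.0 = q2])
    show "lab f = ?lab f" if "f \<in> F0" for f using that h by auto
    show "okb (lab ?h) (a \<in> C) False (b \<in> C) False" if "?h \<in> A"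
      using that plain ok by auto
    show "of_bool su + gain {?h} ?lab g + card {w\<in>W. g w = {w}}
       \<le> of_bool (bonusb (lab {u, a}) q1 p) + of_bool (bonusb (lab {u, b}) q2 r)
         + of_bool (?h \<in> A \<and> bonusb (lab ?h) False False) + card {w\<in>W. g w = {w}}"
      using bits(6) by (simp add: gain_insert gain_empty bonus_doubleton)
    show "C \<subseteq> \<Union>(F0 \<union> {?h}) \<union> W" "\<forall>f\<in>F0 \<union> {?h}. edge_ok (?lab f) C g f"
      "card C \<le> gain (F0 \<union> {?h}) ?lab g + card {w\<in>W. g w = {w}}"
      using C by simp_all
    show "p \<or> False \<longrightarrow> g a = ?h" "r \<or> False \<longrightarrow> g b = ?h" using bits by simp_all
    show "W \<subseteq> W \<union> {a, b}" by auto
  qed (fact fin two u h ne W A C bits | simp)+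
qed

text \<open>Used when the direct edge cannot be absorbed: all three edges go, both neighbours are
  forced, and \<open>merge_bits\<close> turns their payments into bonuses.\<close>

lemma balanced_merge:
  assumes fin: "finite F0" "finite W" and two: "\<forall>f\<in>F0. card f = 2"
    and u: "u \<notin> \<Union>F0" and h: "{a, b} \<notin> F0" and ne: "u \<noteq> a" "u \<noteq> b" "a \<noteq> b"
    and W: "u \<notin> W" "a \<notin> W" "b \<notin> W"
    and lab: "lab {a, b} \<noteq> Plain \<or> series (lab {u, a}) (lab {u, b}) \<noteq> Even"
    and bal: "balanced F0 lab (insert a (insert b W))"
  shows "balanced (F0 \<union> ({{u, a}, {u, b}} \<union> {{a, b}})) lab W"
proof -
  let ?h = "{a, b}" let ?W = "insert a (insert b W)"
  obtain C g where C: "?W \<subseteq> C" "C \<subseteq> \<Union>F0 \<union> ?W" "\<forall>f\<in>F0. edge_ok (lab f) C g f"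
    "card C \<le> gain F0 lab g + card {w\<in>?W. g w = {w}}"
    using bal unfolding balanced_def by blast
  obtain su p q1 q2 r pa ra where bits: "\<not> (q1 \<and> q2)" "\<not> (p \<and> pa)" "\<not> (r \<and> ra)"
     "p \<or> pa \<longrightarrow> g a = {a}" "r \<or> ra \<longrightarrow> g b = {b}"
     "okb (lab {u, a}) su q1 True p" "okb (lab {u, b}) su q2 True r"
     "of_bool su + of_bool (g a = {a}) + of_bool (g b = {b})
       \<le> (of_bool (bonusb (lab {u, a}) q1 p) + of_bool (bonusb (lab {u, b}) q2 r)
          + of_bool (bonusb (lab ?h) pa ra) :: nat)"
    using merge_bits[OF lab, of "g a = {a}" "g b = {b}"] by (elim exE conjE) (rule that)
  have marks: "card {w\<in>?W. g w = {w}} = card {w\<in>W. g w = {w}} + of_bool (g b = {b}) + of_bool (g a = {a})"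
    using marks_insert[of W b g] marks_insert[of "insert b W" a g] fin W ne by simp
  have ok: "okb (lab ?h) True pa True ra" by (cases "lab ?h") auto
  show ?thesis
  proof (rule series_exchange[where C = C and g = g and A' = "{}" and lab' = lab and W' = ?W
        and ka = "{a}" and kb = "{b}" and pa = pa and ra = ra and p = p and r = r
        and su = su and ?q1.0 = q1 and ?q2.0 = q2])
    have ab: "a \<in> C" "b \<in> C" using C(1) by auto
    show "okb (lab {u, a}) su q1 (a \<in> C) p" "okb (lab {u, b}) su q2 (b \<in> C) r"
      "okb (lab ?h) (a \<in> C) pa (b \<in> C) ra"
      using bits ok ab by simp_all
    show "of_bool su + gain {} lab g + card {w\<in>?W. g w = {w}}
       \<le> of_bool (bonusb (lab {u, a}) q1 p) + of_bool (bonusb (lab {u, b}) q2 r)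
         + of_bool (?h \<in> {?h} \<and> bonusb (lab ?h) pa ra) + card {w\<in>W. g w = {w}}"
      using bits(8) unfolding marks by (simp add: gain_empty)
    show "C \<subseteq> \<Union>(F0 \<union> {}) \<union> ?W" "\<forall>f\<in>F0 \<union> {}. edge_ok (lab f) C g f"
      "card C \<le> gain (F0 \<union> {}) lab g + card {w\<in>?W. g w = {w}}"
      using C by simp_all
    show "W \<subseteq> ?W" "?W \<subseteq> W \<union> {a, b}" by auto
  qed (fact fin two u h ne W C bits | simp)+
qed

section \<open>Subdivisions of the complete graph on four vertices\<close>

definition adj_within :: "'a set set \<Rightarrow> 'a set \<Rightarrow> ('a \<times> 'a) set" where
  "adj_within F X = {(x, y). {x, y} \<in> F \<and> x \<in> X \<and> y \<in> X}"

text \<open>Connecting paths are replaced by disjoint sets \<open>S i j\<close> through which the branch vertices are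
  connected.\<close>

definition has_K4_subdivision :: "'a set set \<Rightarrow> bool" where
  "has_K4_subdivision F \<longleftrightarrow> (\<exists>(b :: nat \<Rightarrow> 'a) S. inj_on b {..<4} \<and>
     (\<forall>i j. i < j \<and> j < 4 \<longrightarrow> S i j \<inter> b ` {..<4} = {} \<and>
        (b i, b j) \<in> (adj_within F (S i j \<union> {b i, b j}))\<^sup>* \<and>
        (\<forall>k l. k < l \<and> l < 4 \<and> (i, j) \<noteq> (k, l) \<longrightarrow> S i j \<inter> S k l = {})))"

lemma adj_within_mono: "F \<subseteq> F' \<Longrightarrow> X \<subseteq> X' \<Longrightarrow> adj_within F X \<subseteq> adj_within F' X'"
  unfolding adj_within_def by auto

lemma adj_within_rtrancl_sym: "(x, y) \<in> (adj_within F X)\<^sup>* \<Longrightarrow> (y, x) \<in> (adj_within F X)\<^sup>*"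
  by (rule symD[OF sym_rtrancl]) (auto simp: sym_def adj_within_def insert_commute)

lemma has_K4_subdivision_mono:
  assumes "has_K4_subdivision F" "F \<subseteq> F'"
  shows "has_K4_subdivision F'"
proof -
  have mono: "(adj_within F X)\<^sup>* \<subseteq> (adj_within F' X)\<^sup>*" for X
    by (intro rtrancl_mono adj_within_mono assms(2) order_refl)
  obtain b S where bS: "inj_on b {..<4::nat}" "\<forall>i j. i < j \<and> j < 4 \<longrightarrow> S i j \<inter> b ` {..<4} = {} \<and>
        (b i, b j) \<in> (adj_within F (S i j \<union> {b i, b j}))\<^sup>* \<and>
        (\<forall>k l. k < l \<and> l < 4 \<and> (i, j) \<noteq> (k, l) \<longrightarrow> S i j \<inter> S k l = {})"
    using assms(1) unfolding has_K4_subdivision_def by (elim exE conjE) (rule that)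
  show ?thesis unfolding has_K4_subdivision_def
    by (rule exI[of _ b], rule exI[of _ S]) (use bS subsetD[OF mono] in simp)
qed

lemma adj_within_rtrancl_mem_Union:
  assumes "(x, y) \<in> (adj_within F X)\<^sup>*" "x \<noteq> y"
  shows "x \<in> \<Union>F" "y \<in> \<Union>F"
proof -
  from assms(1) show "x \<in> \<Union>F"
    by (cases rule: converse_rtranclE) (use assms(2) in \<open>auto simp: adj_within_def\<close>)
  from assms(1) show "y \<in> \<Union>F"
    by (cases rule: rtranclE) (use assms(2) in \<open>auto simp: adj_within_def\<close>)
qed

text \<open>The new vertex \<open>u\<close> joins the connecting set that, with its ends, contains
  both \<open>a\<close> and \<open>b\<close>. There is at most one such set, so disjointness
  survives.\<close>

lemma has_K4_subdivision_suppress: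
  assumes K4: "has_K4_subdivision (insert {a, b} F)" and ne: "u \<noteq> a" "u \<noteq> b" "a \<noteq> b" and u: "u \<notin> \<Union>F"
  shows "has_K4_subdivision (F \<union> {{u, a}, {u, b}})"
proof -
  let ?F = "insert {a, b} F" and ?G = "F \<union> {{u, a}, {u, b}}"
  obtain v S where inj: "inj_on v {..<4::nat}"
    and vS: "\<forall>i j. i < j \<and> j < 4 \<longrightarrow> S i j \<inter> v ` {..<4} = {} \<and>
        (v i, v j) \<in> (adj_within ?F (S i j \<union> {v i, v j}))\<^sup>* \<and>
        (\<forall>k l. k < l \<and> l < 4 \<and> (i, j) \<noteq> (k, l) \<longrightarrow> S i j \<inter> S k l = {})"
    using K4 unfolding has_K4_subdivision_def by (elim exE conjE) (rule that)
  have S: "S i j \<inter> v ` {..<4} = {}"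
    and conn: "(v i, v j) \<in> (adj_within ?F (S i j \<union> {v i, v j}))\<^sup>*"
    and disj: "k < l \<Longrightarrow> l < 4 \<Longrightarrow> (i, j) \<noteq> (k, l) \<Longrightarrow> S i j \<inter> S k l = {}"
    if "i < j" "j < 4" for i j k l
    using vS that by simp_all
  have v_eq: "v i = v j \<longleftrightarrow> i = j" if "i < 4" "j < 4" for i j
    using inj that by (auto simp: inj_on_def)
  \<comment> \<open>Branch vertices lie on edges, hence differ from \<open>u\<close>. The last one
    is never the first index of a pair and is treated separately.\<close>
  have vu: "v i \<noteq> u" if "i < 4" for i
  proof -
    have "v i \<in> \<Union>?F"
    proof (cases "i < 3")
      case True
      then show ?thesis using adj_within_rtrancl_mem_Union(1)[OF conn[of i 3]] v_eq by simp
    next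
      case False
      then have "i = 3" using that by simp
      then show ?thesis using adj_within_rtrancl_mem_Union(2)[OF conn[of 0 3]] v_eq[of 0 3] by simp
    qed
    then show ?thesis using u ne by auto
  qed
  define S' where "S' i j = (S i j - {u}) \<union> (if {a, b} \<subseteq> S i j \<union> {v i, v j} then {u} else {})" for i j
  have "(v i, v j) \<in> (adj_within ?G (S' i j \<union> {v i, v j}))\<^sup>*" if ij: "i < j" "j < 4" for i j
  proof -
    let ?X = "S i j \<union> {v i, v j}" and ?Y = "S' i j \<union> {v i, v j}"
    have "(x, y) \<in> (adj_within ?G ?Y)\<^sup>*" if "(x, y) \<in> adj_within ?F ?X" for x y
    proof -
      have xy: "{x, y} \<in> ?F" "x \<in> ?X" "y \<in> ?X" using that by (auto simp: adj_within_def)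
      then have "x \<noteq> u" "y \<noteq> u" using u ne by auto
      then have Y: "x \<in> ?Y" "y \<in> ?Y" using xy by (auto simp: S'_def)
      show ?thesis
      proof (cases "{x, y} \<in> F")
        case True
        then show ?thesis using Y by (intro r_into_rtrancl) (auto simp: adj_within_def)
      next
        case False
        then have eq: "{x, y} = {a, b}" using xy by auto
        then have "{a, b} \<subseteq> ?X" using xy by auto
        then have "u \<in> ?Y" by (simp add: S'_def)
        moreover have "{x, u} \<in> ?G" "{u, y} \<in> ?G" using eq by (auto simp: doubleton_eq_iff insert_commute)
        ultimately have "(x, u) \<in> adj_within ?G ?Y" "(u, y) \<in> adj_within ?G ?Y"
          using Y by (auto simp: adj_within_def)
        then show ?thesis by (meson r_into_rtrancl rtrancl.rtrancl_into_rtrancl)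
      qed
    qed
    then have "(adj_within ?F ?X)\<^sup>* \<subseteq> (adj_within ?G ?Y)\<^sup>*"
      by (intro rtrancl_subset_rtrancl) auto
    then show ?thesis using conn[OF ij] by blast
  qed
  moreover have "S' i j \<inter> S' k l = {}"
    if ij: "i < j" "j < 4" "k < l" "l < 4" "(i, j) \<noteq> (k, l)" for i j k l
  proof -
    have "\<not> ({a, b} \<subseteq> S i j \<union> {v i, v j} \<and> {a, b} \<subseteq> S k l \<union> {v k, v l})"
    proof
      assume *: "{a, b} \<subseteq> S i j \<union> {v i, v j} \<and> {a, b} \<subseteq> S k l \<union> {v k, v l}"
      \<comment> \<open>A vertex common to both sides must be a branch vertex, so \<open>a\<close>
        and \<open>b\<close> would be the two ends of both pairs.\<close>
      have "v i \<in> v ` {..<4}" "v j \<in> v ` {..<4}" "v k \<in> v ` {..<4}" "v l \<in> v ` {..<4}"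
        using ij by auto
      then have "{a, b} \<subseteq> {v i, v j}" "{a, b} \<subseteq> {v k, v l}"
        using * S[OF ij(1,2)] S[OF ij(3,4)] disj[OF ij] by blast+
      then have "{v i, v j} = {v k, v l}" using ne by auto
      then show False using ij v_eq by (auto simp: doubleton_eq_iff)
    qed
    then show ?thesis using disj[OF ij] by (auto simp: S'_def)
  qed
  moreover have "S' i j \<inter> v ` {..<4} = {}" if ij: "i < j" "j < 4" for i j
    using S[OF ij] vu by (auto simp: S'_def)
  ultimately show ?thesis unfolding has_K4_subdivision_def using inj
    by - (rule exI[of _ v], rule exI[of _ S'], simp)
qed

section \<open>Dirac's theorem: minimum degree three forces a subdivision of
  \<open>K\<^sub>4\<close>\<close>

definition edge_path :: "'a set set \<Rightarrow> 'a list \<Rightarrow> bool" where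
  "edge_path F xs \<longleftrightarrow> distinct xs \<and> (\<forall>i. Suc i < length xs \<longrightarrow> {xs ! i, xs ! Suc i} \<in> F)"

lemma edge_path_segment:
  assumes "edge_path F xs" "i \<le> j" "j < length xs" "{i..j} \<subseteq> I"
  shows "(xs ! i, xs ! j) \<in> (adj_within F ((!) xs ` I))\<^sup>*"
  using assms(2-4)
proof (induction j rule: dec_induct)
  case (step j)
  have "(xs ! j, xs ! Suc j) \<in> adj_within F ((!) xs ` I)"
  proof -
    have "j \<in> I" "Suc j \<in> I" using step by auto
    then show ?thesis using assms(1) step(4) by (simp add: adj_within_def edge_path_def)
  qed
  moreover have "{i..j} \<subseteq> I" using step.prems by auto
  then have "(xs ! i, xs ! j) \<in> (adj_within F ((!) xs ` I))\<^sup>*"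
    using step.IH step.prems by simp
  ultimately show ?case by (rule rtrancl.rtrancl_into_rtrancl[rotated])
qed simp

lemma pairs_below_4: "i < j \<Longrightarrow> j < (4::nat) \<Longrightarrow> (i, j) \<in> {(0,1),(0,2),(0,3),(1,2),(1,3),(2,3)}"
  by auto

text \<open>The branch vertices sit at positions \<open>0\<close>, \<open>i - 1\<close>,
  \<open>i\<close> and \<open>lo\<close>. Four connections come from the path and the chord to
  \<open>i\<close>. The other two chords join \<open>0\<close> and \<open>i - 1\<close> to
  \<open>lo\<close>, one directly and one by way of \<open>hi\<close> and back along the
  path.\<close>

lemma has_K4_subdivision_crossing:
  assumes path: "edge_path F xs" and i: "2 \<le> i" "i < lo" "lo \<le> hi" "hi < length xs"
    and edges: "{xs ! 0, xs ! i} \<in> F"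
      "{xs ! 0, xs ! hi} \<in> F \<and> {xs ! (i - 1), xs ! lo} \<in> F \<or> {xs ! 0, xs ! lo} \<in> F \<and> {xs ! (i - 1), xs ! hi} \<in> F"
  shows "has_K4_subdivision F"
proof -
  \<comment> \<open>\<open>c\<close> is the index of the branch vertex whose chord leads to
    \<open>hi\<close>; the one with index \<open>1 - c\<close> has the direct chord to
    \<open>lo\<close>.\<close>
  obtain c :: nat where c: "c = 0 \<and> {xs ! 0, xs ! hi} \<in> F \<and> {xs ! (i - 1), xs ! lo} \<in> F
      \<or> c = 1 \<and> {xs ! 0, xs ! lo} \<in> F \<and> {xs ! (i - 1), xs ! hi} \<in> F"
    using edges(2) by blast
  define t where "t k = [0, i - 1, i, lo] ! k" for k
  have t: "t 0 = 0" "t 1 = i - 1" "t 2 = i" "t 3 = lo" by (simp_all add: t_def)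
  have t4: "t ` {..<4} = {0, i - 1, i, lo}" by (auto simp: t_def numeral_eq_Suc lessThan_Suc)
  \<comment> \<open>Positions of the inner vertices. The detour includes \<open>hi\<close> itself
    and is empty if \<open>lo = hi\<close>.\<close>
  define I where "I k l = (if (k, l) = (0, 1) then {0<..<i - 1} else if (k, l) = (2, 3) then {i<..<lo}
    else if (k, l) = (c, 3) then {lo<..hi} else {})" for k l :: nat
  define b where "b k = xs ! t k" for k
  define S where "S k l = (!) xs ` I k l" for k l
  have nth_eq: "xs ! k = xs ! l \<longleftrightarrow> k = l" if "k < length xs" "l < length xs" for k l
    using path that by (simp add: edge_path_def nth_eq_iff_index_eq)
  have bound: "t k < length xs" if "k < 4" for k
  proof -
    have "t k \<in> {0, i - 1, i, lo}" using t4 that by blast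
    then show ?thesis using i by auto
  qed
  have t_inj: "inj_on t {..<4}"
    using i by (auto simp: inj_on_def t_def less_Suc_eq numeral_eq_Suc)
  have b_inj: "inj_on b {..<4}"
    using t_inj nth_eq bound by (auto simp: inj_on_def b_def)
  have I_bound: "I k l \<subseteq> {..<length xs}" for k l using i by (auto simp: I_def)
  have inj: "inj_on ((!) xs) {..<length xs}" using nth_eq by (auto simp: inj_on_def)
  have "I k l \<inter> t ` {..<4} = {}" for k l
    unfolding t4 using i by (auto simp: I_def)
  then have S_b: "S k l \<inter> b ` {..<4} = {}" for k l
  proof -
    have "b ` {..<4} = (!) xs ` (t ` {..<4})" by (auto simp: b_def)
    moreover have "t ` {..<4} \<subseteq> {..<length xs}" using bound by auto
    ultimately show ?thesis
      using inj_on_image_Int[OF inj I_bound[of k l], of "t ` {..<4}"] \<open>I k l \<inter> t ` {..<4} = {}\<close>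
      by (simp add: S_def)
  qed
  have S_disj: "S k l \<inter> S k' l' = {}" if "(k, l) \<noteq> (k', l')" for k l k' l'
  proof -
    have "I k l \<inter> I k' l' = {}" using that i c by (auto simp: I_def split: if_splits)
    then show ?thesis using inj_on_image_Int[OF inj I_bound[of k l] I_bound[of k' l']]
      by (simp add: S_def)
  qed
  have step: "(b k, b l) \<in> (adj_within F (S k l \<union> {b k, b l}))\<^sup>*" if "{b k, b l} \<in> F" for k l
    using that by (intro r_into_rtrancl) (auto simp: adj_within_def)
  have conn: "(b k, b l) \<in> (adj_within F (S k l \<union> {b k, b l}))\<^sup>*" if kl: "k < l" "l < 4" for k l
  proof -
    have X: "S k l \<union> {b k, b l} = (!) xs ` (I k l \<union> {t k, t l})" by (auto simp: S_def b_def)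
    have detour: "(b d, b 3) \<in> (adj_within F (S d 3 \<union> {b d, b 3}))\<^sup>*" if "d = c" for d
    proof -
      have X: "S d 3 \<union> {b d, b 3} = (!) xs ` (I d 3 \<union> {t d, t 3})" by (auto simp: S_def b_def)
      have sub: "{lo..hi} \<subseteq> I d 3 \<union> {t d, t 3}" using that c t by (auto simp: I_def)
      have "(xs ! hi, b 3) \<in> (adj_within F (S d 3 \<union> {b d, b 3}))\<^sup>*"
        unfolding X using edge_path_segment[OF path i(3,4) sub] t
        by (simp add: b_def adj_within_rtrancl_sym)
      moreover have "(b d, xs ! hi) \<in> adj_within F (S d 3 \<union> {b d, b 3})"
        unfolding X using that c t i sub by (auto simp: adj_within_def b_def)
      ultimately show ?thesis by (rule converse_rtrancl_into_rtrancl[rotated])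
    qed
    have direct: "{b (1 - c), b 3} \<in> F" using c t by (auto simp: b_def)
    consider "(k, l) = (0, 1)" | "(k, l) = (2, 3)" | "(k, l) = (0, 2)" | "(k, l) = (1, 2)"
      | "(k, l) = (c, 3)" | "(k, l) = (1 - c, 3)"
      using pairs_below_4[OF kl] c by auto
    then show ?thesis
    proof cases
      case 1
      then have "{0..i - 1} \<subseteq> I k l \<union> {t k, t l}" using t by (auto simp: I_def)
      moreover have "b k = xs ! 0" "b l = xs ! (i - 1)" using 1 t by (auto simp: b_def)
      ultimately show ?thesis unfolding X using i by (simp only:) (rule edge_path_segment[OF path], auto)
    next
      case 2
      then have "{i..lo} \<subseteq> I k l \<union> {t k, t l}" using t by (auto simp: I_def)
      moreover have "b k = xs ! i" "b l = xs ! (lo)" using 2 t by (auto simp: b_def)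
      ultimately show ?thesis unfolding X using i by (simp only:) (rule edge_path_segment[OF path], auto)
    next
      case 3
      then show ?thesis using edges(1) t by (intro step) (auto simp: b_def)
    next
      case 4
      have "Suc (i - 1) = i" using i by simp
      then have "{xs ! (i - 1), xs ! i} \<in> F" using path i unfolding edge_path_def
        by (metis less_le_trans less_trans)
      then show ?thesis using 4 t by (intro step) (auto simp: b_def)
    next
      case 5
      then show ?thesis using detour by auto
    next
      case 6
      then show ?thesis using direct by (intro step) auto
    qed
  qed
  show ?thesis
    unfolding has_K4_subdivision_def using b_inj S_b conn S_disj by blast
qed

lemma rotate_prefix_nth:
  assumes "k < length xs" "i \<le> length xs"
  shows "(rev (take i xs) @ drop i xs) ! k = (if k < i then xs ! (i - 1 - k) else xs ! k)"
  using assms by (auto simp: nth_append rev_nth)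

text \<open>Posa rotation: the chord from the first vertex to position \<open>i\<close> replaces the
  path edge into position \<open>i\<close>, and the vertex at \<open>i - 1\<close> becomes the first
  one.\<close>

lemma edge_path_rotate:
  assumes path: "edge_path F xs" and i: "0 < i" "i < length xs" "{xs ! 0, xs ! i} \<in> F"
  shows "edge_path F (rev (take i xs) @ drop i xs)"
proof -
  let ?ys = "rev (take i xs) @ drop i xs"
  have "distinct ?ys" using path set_take_disj_set_drop_if_distinct[of xs i i]
    by (auto simp: edge_path_def)
  moreover have "{?ys ! k, ?ys ! Suc k} \<in> F" if "Suc k < length ?ys" for k
  proof -
    have k: "Suc k < length xs" using that i by simp
    consider "Suc k < i" | "Suc k = i" | "i \<le> k" by linarith
    then show ?thesis
    proof cases
      case 1
      then have "Suc (i - 1 - Suc k) = i - 1 - k" by simp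
      then have "{xs ! (i - 1 - Suc k), xs ! (i - 1 - k)} \<in> F"
        using path i unfolding edge_path_def by (metis diff_le_self le_less_trans less_imp_diff_less)
      then show ?thesis using 1 k i by (simp add: rotate_prefix_nth insert_commute)
    next
      case 2
      then show ?thesis using k i by (auto simp: rotate_prefix_nth)
    next
      case 3
      then show ?thesis using k i path by (simp add: rotate_prefix_nth edge_path_def)
    qed
  qed
  ultimately show ?thesis by (simp add: edge_path_def)
qed

text \<open>Dirac's theorem by rotations of a longest path: the third neighbour of the vertex in front of
  a chord either crosses the chord or yields, after rotation, a shorter one.\<close>

lemma longest_path_K4:
  assumes deg: "\<And>x y z. x \<in> \<Union>F \<Longrightarrow> \<exists>w. {x, w} \<in> F \<and> w \<noteq> y \<and> w \<noteq> z"
    and two: "\<forall>f\<in>F. card f = 2"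
    and max: "\<And>ys. edge_path F ys \<Longrightarrow> length ys \<le> n"
  shows "edge_path F xs \<Longrightarrow> length xs = n \<Longrightarrow> 2 \<le> i \<Longrightarrow> i < length xs \<Longrightarrow> {xs ! 0, xs ! i} \<in> F
    \<Longrightarrow> has_K4_subdivision F"
proof (induction i arbitrary: xs rule: less_induct)
  case (less i)
  have nbr: "w \<in> set ys" if ys: "edge_path F ys" "length ys = n" "ys \<noteq> []" and w: "{ys ! 0, w} \<in> F" for ys w
  proof (rule ccontr)
    assume "w \<notin> set ys"
    then have "edge_path F (w # ys)"
      using ys w unfolding edge_path_def by (auto simp: nth_Cons insert_commute split: nat.splits)
    then show False using max[of "w # ys"] ys by simp
  qed
  have nbr_index: "\<exists>k<n. k \<notin> {0, p, q} \<and> {ys ! 0, ys ! k} \<in> F"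
    if ys: "edge_path F ys" "length ys = n" "p < n" "q < n" "{ys ! 0, ys ! p} \<in> F" for ys p q
  proof -
    have "ys ! 0 \<in> \<Union>F" using ys by auto
    then obtain w where w: "{ys ! 0, w} \<in> F" "w \<noteq> ys ! p" "w \<noteq> ys ! q" using deg by blast
    moreover have "w \<noteq> ys ! 0" using two w by force
    moreover have "ys \<noteq> []" using ys by auto
    then have "w \<in> set ys" using nbr[of ys w] ys w(1) by blast
    then obtain k where "k < n" "w = ys ! k" using ys(2) by (auto simp: in_set_conv_nth)
    ultimately have "k < n \<and> k \<notin> {0, p, q} \<and> {ys ! 0, ys ! k} \<in> F" by blast
    then show ?thesis by blast
  qed
  let ?ys = "rev (take i xs) @ drop i xs"
  have rot: "edge_path F ?ys" "length ?ys = n" using edge_path_rotate[of F xs i] less.prems by auto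
  have ys0: "?ys ! 0 = xs ! (i - 1)" using rotate_prefix_nth[of 0 xs i] less.prems by auto
  have ysi: "?ys ! i = xs ! i" using rotate_prefix_nth[of i xs i] less.prems by auto
  \<comment> \<open>The path edge given up by the rotation becomes a chord of the rotated path,
    again at position \<open>i\<close>.\<close>
  have "Suc (i - 1) = i" using less.prems(3) by simp
  then have pred: "{xs ! (i - 1), xs ! i} \<in> F"
    using less.prems(1,4) unfolding edge_path_def by metis
  obtain j where j: "j < n" "j \<noteq> 0" "j \<noteq> 1" "j \<noteq> i" "{xs ! 0, xs ! j} \<in> F"
    using nbr_index[of xs i 1] less.prems by auto
  obtain k where k: "k < n" "k \<noteq> 0" "k \<noteq> 1" "k \<noteq> i" "{?ys ! 0, ?ys ! k} \<in> F"
    using nbr_index[of ?ys i 1] rot less.prems pred ys0 ysi by auto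
  consider "j < i" | "k < i" | "i < j" "i < k" using j k by linarith
  then show ?case
  proof cases
    case 1
    then show ?thesis using less.IH[of j xs] less.prems j by auto
  next
    case 2
    then show ?thesis using less.IH[of k ?ys] rot k by auto
  next
    case 3
    \<comment> \<open>The rotation leaves positions beyond \<open>i\<close> alone, so both chords
      end on the same segment of \<open>xs\<close>, in one order or the other.\<close>
    have "{xs ! (i - 1), xs ! k} \<in> F"
      using k ys0 rotate_prefix_nth[of k xs i] 3 less.prems by auto
    then show ?thesis
      using has_K4_subdivision_crossing[of F xs i "min j k" "max j k"] 3 less.prems j k
      by (cases "j \<le> k") (auto simp: min_def max_def)
  qed
qed

text \<open>\<open>deg\<close> expresses minimum degree three without counting: no two vertices
  exhaust a neighbourhood. On a longest path, a neighbour of the first vertex other than its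
  successor gives the chord from which \<open>longest_path_K4\<close> starts.\<close>

lemma min_degree_3_has_K4_subdivision:
  assumes fin: "finite F" and two: "\<forall>f\<in>F. card f = 2" and ne: "F \<noteq> {}"
    and deg: "\<And>x y z. x \<in> \<Union>F \<Longrightarrow> \<exists>w. {x, w} \<in> F \<and> w \<noteq> y \<and> w \<noteq> z"
  shows "has_K4_subdivision F"
proof -
  let ?L = "{length xs |xs. edge_path F xs}"
  \<comment> \<open>The successor makes the bound immediate for lists of at most one vertex, which
    need not meet any edge.\<close>
  have "length xs \<le> Suc (card (\<Union>F))" if "edge_path F xs" for xs
  proof (cases "length xs \<le> 1")
    case False
    have "xs ! i \<in> \<Union>F" if "i < length xs" for i
    proof (cases "Suc i < length xs")
      case True
      then show ?thesis using \<open>edge_path F xs\<close> unfolding edge_path_def by blast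
    next
      case F: False
      then have "Suc (i - 1) = i" "Suc (i - 1) < length xs" using that False by auto
      then show ?thesis using \<open>edge_path F xs\<close> unfolding edge_path_def
        by (metis UnionI insertCI)
    qed
    then have "set xs \<subseteq> \<Union>F" by (auto simp: in_set_conv_nth)
    then have "card (set xs) \<le> card (\<Union>F)" using finite_Union_edges[OF fin two] by (rule card_mono[rotated])
    then show ?thesis using that by (simp add: edge_path_def distinct_card)
  qed auto
  then have finL: "finite ?L" by (auto simp: finite_nat_set_iff_bounded_le)
  obtain f where "f \<in> F" using ne by blast
  then obtain a b where ab: "{a, b} \<in> F" "a \<noteq> b" using two by (metis card_2_iff)
  then obtain c where c: "{b, c} \<in> F" "c \<noteq> a" "c \<noteq> b" using deg[of b a b] by blast
  have P: "edge_path F [a, b, c]" using ab c by (auto simp: edge_path_def less_Suc_eq)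
  define n where "n = Max ?L"
  have max: "length ys \<le> n" if "edge_path F ys" for ys
    unfolding n_def using finL that by (intro Max_ge) auto
  have "n \<in> ?L" unfolding n_def using finL P by (intro Max_in) auto
  then obtain xs where xs: "edge_path F xs" "length xs = n" by auto
  have n: "3 \<le> n" using max[OF P] by simp
  have e01: "{xs ! 0, xs ! 1} \<in> F" using xs n by (auto simp: edge_path_def)
  then obtain w where w: "{xs ! 0, w} \<in> F" "w \<noteq> xs ! 0" "w \<noteq> xs ! 1"
    using deg[of "xs ! 0" "xs ! 0" "xs ! 1"] by blast
  have "w \<in> set xs"
  proof (rule ccontr)
    assume "w \<notin> set xs"
    then have "edge_path F (w # xs)"
      using xs w unfolding edge_path_def by (auto simp: nth_Cons insert_commute split: nat.splits)
    then show False using max[of "w # xs"] xs by simp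
  qed
  then obtain i where i: "i < n" "w = xs ! i" using xs by (auto simp: in_set_conv_nth)
  then have "2 \<le> i" using w by (metis One_nat_def less_2_cases not_less)
  then show ?thesis using longest_path_K4[OF deg two max xs] i w xs by blast
qed

section \<open>Series-parallel induction\<close>

lemma doubleton_of_mem:
  assumes "card f = 2" "x \<in> f"
  obtains y where "f = {x, y}" "x \<noteq> y"
  using assms by (auto simp: card_2_iff)

text \<open>Induction on the number of edges, for all \<open>lab\<close> and \<open>W\<close>
  because the reductions change both. Edges at forced vertices go first. Once \<open>W\<close> is
  isolated, Dirac's theorem supplies a vertex \<open>u\<close> with at most two neighbours, where a
  leaf, series or merge step applies.\<close>

lemma balanced_if_no_K4_subdivision:
  assumes "finite F" "finite W" "\<forall>f\<in>F. card f = 2" "\<not> has_K4_subdivision F"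
  shows "balanced F lab W"
  using assms
proof (induction "card F" arbitrary: F lab W rule: less_induct)
  case less
  note fin = less.prems(1,2) and two = less.prems(3) and noK4 = less.prems(4)
  have smaller: "balanced F' lab' W'"
    if "F' \<subset> F" "finite W'" for F' :: "'a set set" and lab' W'
    using less.hyps[of F' W' lab'] that fin two noK4 has_K4_subdivision_mono[of F' F]
    by (auto simp: psubset_card_mono intro: finite_subset)
  show ?case
  proof (cases "W \<inter> \<Union>F = {}")
    case False
    then obtain w f where wf: "w \<in> W" "f \<in> F" "w \<in> f" by blast
    then obtain b where b: "f = {w, b}" "w \<noteq> b" using two by (metis doubleton_of_mem)
    show ?thesis
    proof (cases "b \<in> W \<or> lab f = Plain")
      case True
      then show ?thesis
        using balanced_forced_edge[of F f W lab] smaller[of "F - {f}" W lab] wf b fin by auto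
    next
      case False
      then show ?thesis
        using balanced_spread[of F W w b lab] smaller[of "F - {f}" "insert b W" lab] wf b fin two by auto
    qed
  next
    case W: True
    show ?thesis
    proof (cases "F = {}")
      case True
      \<comment> \<open>Without edges, the forced vertices pay for themselves.\<close>
      have "gain {} lab (\<lambda>w. {w}) + card {w\<in>W. {w} = {w}} = card W" by (simp add: gain_empty)
      then show ?thesis unfolding balanced_def True
        by (intro exI[of _ W] exI[of _ "\<lambda>w. {w}"]) simp
    next
      case False
      then obtain u y z where u: "u \<in> \<Union>F" and yz: "\<And>w. {u, w} \<in> F \<Longrightarrow> w = y \<or> w = z"
        using min_degree_3_has_K4_subdivision[OF fin(1) two] noK4 by blast
      then obtain f a where f: "f \<in> F" "f = {u, a}" "u \<noteq> a" using two by (metis UnionE doubleton_of_mem)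
      have at_u: "\<exists>w. f' = {u, w}" if "f' \<in> F" "u \<in> f'" for f'
        using that two by (metis doubleton_of_mem)
      have notW: "u \<notin> W" "a \<notin> W" using W f by auto
      show ?thesis
      proof (cases "\<exists>b. b \<noteq> a \<and> {u, b} \<in> F")
        case False
        have "u \<notin> f'" if f': "f' \<in> F - {{u, a}}" for f'
        proof
          assume "u \<in> f'"
          then obtain w where "f' = {u, w}" using at_u f' by blast
          then show False using False f' by (cases "w = a") auto
        qed
        then have "u \<notin> \<Union>(F - {{u, a}})" by blast
        then show ?thesis
          using balanced_leaf[of F W u a lab] smaller[of "F - {f}" "insert a W" lab] f fin two notW by auto
      next
        case True
        then obtain b where b: "b \<noteq> a" "{u, b} \<in> F" by blast
        then have only: "w = a \<or> w = b" if "{u, w} \<in> F" for w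
          using yz that f by blast
        have ub: "u \<noteq> b" using two b by force
        have bW: "b \<notin> W" using W b by auto
        define F0 where "F0 = F - {{u, a}, {u, b}, {a, b}}"
        define A where "A = F \<inter> {{a, b}}"
        have F: "F = F0 \<union> ({{u, a}, {u, b}} \<union> A)" using f b by (auto simp: F0_def A_def)
        have "u \<notin> f'" if f': "f' \<in> F0" for f'
        proof
          assume "u \<in> f'"
          then obtain w where "f' = {u, w}" using at_u f' by (auto simp: F0_def)
          then show False using only[of w] f' by (auto simp: F0_def)
        qed
        then have u0: "u \<notin> \<Union>F0" by blast
        have sub: "F0 \<union> {{u, a}, {u, b}} \<subseteq> F" using f b by (auto simp: F0_def)
        have F0: "finite F0" "\<forall>f\<in>F0. card f = 2" "{a, b} \<notin> F0" "F0 \<subset> F"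
          using fin two f by (auto simp: F0_def)
        show ?thesis
        proof (cases "A = {} \<or> lab {a, b} = Plain \<and> series (lab {u, a}) (lab {u, b}) = Even")
          case True
          have "\<not> has_K4_subdivision (insert {a, b} F0)"
          proof
            assume "has_K4_subdivision (insert {a, b} F0)"
            then have "has_K4_subdivision (F0 \<union> {{u, a}, {u, b}})"
              using has_K4_subdivision_suppress[of a b F0 u] u0 f(3) ub b(1) by simp
            then show False using noK4 has_K4_subdivision_mono[OF _ sub] by simp
          qed
          \<comment> \<open>Two edges leave and at most one arrives; a plain edge in
            \<open>A\<close> is replaced by the composed one.\<close>
          moreover have "card (insert {a, b} F0) < card F"
          proof -
            have "{u, a} \<noteq> {u, b}" using b by (auto simp: doubleton_eq_iff)
            moreover have "{u, a} \<notin> F0" "{u, b} \<notin> F0" using u0 by auto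
            ultimately have "card (F0 \<union> {{u, a}, {u, b}}) = card F0 + 2" using F0 by simp
            moreover have "card (F0 \<union> {{u, a}, {u, b}}) \<le> card F"
              using sub fin(1) by (intro card_mono)
            ultimately show ?thesis using F0 by simp
          qed
          ultimately have "balanced (insert {a, b} F0) (lab({a, b} := series (lab {u, a}) (lab {u, b}))) W"
            using F0(1,2) fin(2) b(1) less.hyps[of "insert {a, b} F0"] by simp
          moreover have "A \<subseteq> {{a, b}}" by (simp add: A_def)
          ultimately have "balanced (F0 \<union> ({{u, a}, {u, b}} \<union> A)) lab W"
            by (intro balanced_series[OF F0(1) fin(2) F0(2) u0 F0(3) f(3) ub b(1)[symmetric] notW bW _ True])
          then show ?thesis using F by simp
        next
          case False
          then have A: "A = {{a, b}}" by (auto simp: A_def)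
          have "balanced F0 lab (insert a (insert b W))"
            using smaller F0(4) fin(2) by simp
          moreover have "lab {a, b} \<noteq> Plain \<or> series (lab {u, a}) (lab {u, b}) \<noteq> Even" using False by simp
          ultimately have "balanced (F0 \<union> ({{u, a}, {u, b}} \<union> {{a, b}})) lab W"
            by (intro balanced_merge[OF F0(1) fin(2) F0(2) u0 F0(3) f(3) ub b(1)[symmetric] notW bW])
          then show ?thesis using F A by simp
        qed
      qed
    qed
  qed
qed

text \<open>All labels plain and nothing forced: the edges with a bonus are those marked at both
  ends, and they form a matching because \<open>g\<close> gives each vertex a single mark.\<close>

lemma no_K4_subdivision_matching_cover:
  assumes fin: "finite F" and two: "\<forall>f\<in>F. card f = 2" and K4: "\<not> has_K4_subdivision F"
  obtains M C where "M \<subseteq> F" "pairwise (\<lambda>s t. s \<inter> t = {}) M" "C \<subseteq> \<Union>F" "\<And>f. f \<in> F - M \<Longrightarrow> f \<inter> C \<noteq> {}" "card C \<le> card M"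
proof -
  obtain C g where C: "C \<subseteq> \<Union>F" "\<forall>f\<in>F. edge_ok Plain C g f" "card C \<le> gain F (\<lambda>_. Plain) g"
    using balanced_if_no_K4_subdivision[OF fin finite.emptyI two K4, of "\<lambda>_. Plain"]
    unfolding balanced_def by auto
  define M where "M = {f\<in>F. \<forall>x\<in>f. g x = f}"
  have "gain F (\<lambda>_. Plain) g = card M" using fin by (simp add: gain_def M_def Int_def)
  moreover have "pairwise (\<lambda>s t. s \<inter> t = {}) M" unfolding M_def pairwise_def by fast
  ultimately show thesis using C by (intro that[of M C]) (auto simp: M_def)
qed

section \<open>Links and triangles\<close>

text \<open>The path is built backwards from \<open>y\<close>; if the new first vertex already
  occurs, everything before its occurrence is cut off.\<close>

lemma adj_within_rtrancl_path:
  assumes "(x, y) \<in> (adj_within F X)\<^sup>*" "x \<in> X"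
  shows "\<exists>p. p \<noteq> [] \<and> hd p = x \<and> last p = y \<and> edge_path F p \<and> set p \<subseteq> X"
  using assms
proof (induction rule: converse_rtrancl_induct)
  case base
  then show ?case by (intro exI[of _ "[y]"]) (auto simp: edge_path_def)
next
  case (step x z)
  then obtain p where p: "p \<noteq> []" "hd p = z" "last p = y" "edge_path F p" "set p \<subseteq> X"
    by (auto simp: adj_within_def)
  show ?case
  proof (cases "x \<in> set p")
    case True
    then obtain as bs where "p = as @ x # bs" by (meson split_list)
    moreover have "edge_path F (x # bs)" if "edge_path F (as @ x # bs)"
      unfolding edge_path_def
    proof (intro conjI allI impI)
      show "distinct (x # bs)" using that by (auto simp: edge_path_def)
      show "{(x # bs) ! i, (x # bs) ! Suc i} \<in> F" if "Suc i < length (x # bs)" for i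
        using \<open>edge_path F (as @ x # bs)\<close>[unfolded edge_path_def, THEN conjunct2, rule_format, of "length as + i"] that
        by (simp add: nth_append)
    qed
    ultimately show ?thesis using p by (intro exI[of _ "x # bs"]) auto
  next
    case False
    have "edge_path F (x # p)"
      using p False step.hyps unfolding edge_path_def
      by (auto simp: nth_Cons adj_within_def hd_conv_nth split: nat.splits)
    then show ?thesis using p step.prems by (intro exI[of _ "x # p"]) auto
  qed
qed

text \<open>The inequalities with \<open>v\<close> keep \<open>v\<close> off its own link even if
  \<open>E\<close> contains singletons.\<close>

definition link :: "'a set set \<Rightarrow> 'a \<Rightarrow> 'a set set" where
  "link E v = {{x, y} |x y. x \<noteq> y \<and> {x, y} \<in> E \<and> {v, x} \<in> E \<and> {v, y} \<in> E \<and> v \<noteq> x \<and> v \<noteq> y}"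

text \<open>\<open>v\<close> is adjacent to every vertex of its link, so it serves as fifth branch
  vertex, joined to the other four by single edges.\<close>

lemma K5_subdivision_of_link:
  assumes G: "simple_graph V E" and K4: "has_K4_subdivision (link E v)"
  shows "has_K5_subdivision V E"
proof -
  let ?F = "link E v"
  obtain b S where inj: "inj_on b {..<4::nat}"
    and bS: "\<forall>i j. i < j \<and> j < 4 \<longrightarrow> S i j \<inter> b ` {..<4} = {} \<and>
        (b i, b j) \<in> (adj_within ?F (S i j \<union> {b i, b j}))\<^sup>* \<and>
        (\<forall>k l. k < l \<and> l < 4 \<and> (i, j) \<noteq> (k, l) \<longrightarrow> S i j \<inter> S k l = {})"
    using K4 unfolding has_K4_subdivision_def by (elim exE conjE) (rule that)
  have S: "S i j \<inter> b ` {..<4} = {}"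
    and conn: "(b i, b j) \<in> (adj_within ?F (S i j \<union> {b i, b j}))\<^sup>*"
    and disj: "k < l \<Longrightarrow> l < 4 \<Longrightarrow> (i, j) \<noteq> (k, l) \<Longrightarrow> S i j \<inter> S k l = {}"
    if "i < j" "j < 4" for i j k l
    using bS that by simp_all
  have b_eq: "b i = b j \<longleftrightarrow> i = j" if "i < 4" "j < 4" for i j
    using inj that by (auto simp: inj_on_def)
  have b_mem: "b i \<in> \<Union>?F" if "i < 4" for i
  proof (cases "i < 3")
    case True
    then show ?thesis using adj_within_rtrancl_mem_Union(1)[OF conn[of i 3]] b_eq by simp
  next
    case False
    then have "i = 3" using that by simp
    then show ?thesis using adj_within_rtrancl_mem_Union(2)[OF conn[of 0 3]] b_eq[of 0 3] by simp
  qed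
  have link_mem: "x \<noteq> v" "{x, v} \<in> E" "x \<in> V" "v \<in> V" if "x \<in> \<Union>?F" for x
  proof -
    show x: "x \<noteq> v" "{x, v} \<in> E" using that by (auto simp: link_def insert_commute)
    then show "x \<in> V" "v \<in> V" using G unfolding simple_graph_def by (metis doubleton_eq_iff)+
  qed
  have sub: "?F \<subseteq> E" by (auto simp: link_def)
  have "\<exists>p. is_path E p \<and> hd p = b i \<and> last p = b j \<and> interior p \<subseteq> S i j - {v}"
    if ij: "i < j" "j < 4" for i j
  proof -
    obtain p where p: "p \<noteq> []" "hd p = b i" "last p = b j" "edge_path ?F p" "set p \<subseteq> S i j \<union> {b i, b j}"
      using adj_within_rtrancl_path[OF conn[OF ij]] by auto
    have ne: "b i \<noteq> b j" using b_eq ij by simp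
    obtain q where q: "p = b i # q" "q \<noteq> []" "last q = b j" using p ne by (cases p) (auto split: if_splits)
    then have p_eq: "p = b i # butlast q @ [b j]" by (metis append_butlast_last_id)
    have int: "interior p = set (butlast q)" using q by (simp add: interior_def)
    have d: "distinct p" using p by (simp add: edge_path_def)
    then have "b i \<notin> set (butlast q)" "b j \<notin> set (butlast q)" unfolding p_eq by auto
    then have "interior p \<subseteq> S i j" using p(5) int unfolding p_eq by auto
    \<comment> \<open>A connecting set may contain \<open>v\<close>, but a path in the link cannot
      visit it, since its inner vertices lie on link edges.\<close>
    moreover have "v \<notin> interior p"
    proof
      assume "v \<in> interior p"
      then obtain k where k: "k < length (butlast q)" "butlast q ! k = v" unfolding int by (meson in_set_conv_nth)
      then have "p ! Suc k = v" unfolding p_eq by (simp add: nth_append)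
      moreover have "Suc k < length p" unfolding p_eq using k by simp
      ultimately have "{p ! k, v} \<in> ?F" using p(4) unfolding edge_path_def by metis
      then show False using link_mem(1)[of v] by blast
    qed
    moreover have "is_path E p" using p(4) sub d unfolding is_path_def edge_path_def p_eq by auto
    ultimately show ?thesis using p by blast
  qed
  note ex = this
  define Q where "Q i j = (SOME p. is_path E p \<and> hd p = b i \<and> last p = b j \<and> interior p \<subseteq> S i j - {v})" for i j
  have Q: "is_path E (Q i j)" "hd (Q i j) = b i" "last (Q i j) = b j" "interior (Q i j) \<subseteq> S i j - {v}"
    if "i < j" "j < 4" for i j
    using someI_ex[OF ex[OF that]] unfolding Q_def by simp_all
  define c where "c = b(4 := v)"
  \<comment> \<open>The fifth branch vertex has the largest index, so it occurs in a pair
    \<open>i < j\<close> only as \<open>j = 4\<close>.\<close>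
  define P where "P i j = (if j = 4 then [b i, v] else Q i j)" for i j :: nat
  have below_5: "{0..<5::nat} = insert 4 {..<4}" by auto
  then have range: "c ` {0..<5} = insert v (b ` {..<4})" by (auto simp: c_def)
  have b_ne: "b i \<noteq> v" if "i < 4" for i using link_mem(1)[OF b_mem[OF that]] .
  have "inj_on c {0..<5}"
  proof -
    have "inj_on c {..<4}" using inj by (simp add: inj_on_def c_def)
    moreover have "c 4 \<notin> c ` {..<4}" using b_ne by (auto simp: c_def)
    ultimately show ?thesis unfolding below_5 by simp
  qed
  moreover have "c ` {0..<5} \<subseteq> V"
  proof -
    have "b i \<in> V" "v \<in> V" if "i < 4" for i using link_mem(3,4)[OF b_mem[OF that]] .
    from this(1) this(2)[of 0] show ?thesis unfolding range by auto
  qed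
  moreover have "is_path E (P i j) \<and> hd (P i j) = c i \<and> last (P i j) = c j \<and> interior (P i j) \<inter> c ` {0..<5} = {}"
    if ij: "i < j" "j < 5" for i j
  proof (cases "j = 4")
    case True
    then show ?thesis using ij b_ne[of i] link_mem(2)[OF b_mem[of i]]
      by (auto simp: P_def c_def is_path_def interior_def)
  next
    case False
    then have "j < 4" using ij by simp
    then show ?thesis using Q[OF ij(1)] S[OF ij(1)] ij unfolding range by (auto simp: P_def c_def)
  qed
  moreover have "interior (P i j) \<inter> interior (P k l) = {}"
    if "i < j" "j < 5" "k < l" "l < 5" "(i, j) \<noteq> (k, l)" for i j k l
  proof (cases "j = 4 \<or> l = 4")
    case True
    then show ?thesis by (auto simp: P_def interior_def)
  next
    case False
    then have "j < 4" "l < 4" using that by auto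
    then show ?thesis using disj[of i j k l] Q(4)[of i j] Q(4)[of k l] that False by (fastforce simp: P_def)
  qed
  ultimately show ?thesis unfolding has_K5_subdivision_def
    by - (rule exI[of _ c], rule exI[of _ P], simp)
qed

section \<open>Packing and destroying the triangles around a vertex\<close>

lemma link_mono: "E \<subseteq> E' \<Longrightarrow> link E v \<subseteq> link E' v"
  unfolding link_def by blast

lemma triangles_mono: "E \<subseteq> E' \<Longrightarrow> triangles E \<subseteq> triangles E'"
  unfolding triangles_def by blast

lemma triangle_subset: "t \<in> triangles E \<Longrightarrow> t \<subseteq> E"
  unfolding triangles_def by auto

lemma triangle_at_vertex:
  assumes "t \<in> triangles E" "{v, x} \<in> t"
  obtains y where "{x, y} \<in> link E v" "{x, y} \<in> t" "{v, y} \<in> t"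
proof -
  obtain a b c where abc: "a \<noteq> b" "b \<noteq> c" "a \<noteq> c" "{a, b} \<in> E" "{b, c} \<in> E" "{a, c} \<in> E"
    "t = {{a, b}, {b, c}, {a, c}}"
    using assms(1) unfolding triangles_def by blast
  have "\<exists>y. v \<noteq> x \<and> x \<noteq> y \<and> v \<noteq> y \<and> {x, y} \<in> t \<and> {v, y} \<in> t"
    using assms(2) abc(1-3) unfolding abc(7) by (auto simp: doubleton_eq_iff)
  then obtain y where "v \<noteq> x" "x \<noteq> y" "v \<noteq> y" "{x, y} \<in> t" "{v, y} \<in> t" by blast
  moreover from this have "{x, y} \<in> link E v"
    using assms triangle_subset[OF assms(1)] unfolding link_def by blast
  ultimately show thesis using that by blast
qed

text \<open>For a link edge \<open>m\<close>, this is the triangle over \<open>m\<close> with apex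
  \<open>v\<close>.\<close>

definition cone :: "'a \<Rightarrow> 'a set \<Rightarrow> 'a set set" where
  "cone v m = insert m ((\<lambda>x. {v, x}) ` m)"

lemma mem_cone: "m \<in> cone v m"
  by (simp add: cone_def)

lemma cone_triangle: "m \<in> link E v \<Longrightarrow> cone v m \<in> triangles E"
  unfolding link_def triangles_def cone_def by (auto simp: insert_commute)

lemma cone_disjoint:
  assumes "m \<in> link E v" "m' \<in> link E v" "m \<inter> m' = {}"
  shows "cone v m \<inter> cone v m' = {}"
  using assms unfolding link_def cone_def by (auto simp: doubleton_eq_iff)

lemma triangle_packing_and_cover:
  assumes "finite E" "\<And>v. \<not> has_K4_subdivision (link E v)"
  shows "\<exists>Y T. Y \<subseteq> E \<and> triangles (E - Y) = {} \<and> T \<subseteq> triangles E \<and> pairwise (\<lambda>s t. s \<inter> t = {}) T \<and> card Y \<le> 2 * card T"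
  using assms
proof (induction "card E" arbitrary: E rule: less_induct)
  case less
  note fin = less.prems(1)
  show ?case
  proof (cases "triangles E = {}")
    case True
    then show ?thesis by (intro exI[of _ "{}"]) auto
  next
    case False
    then obtain v x y where "{x, y} \<in> link E v" unfolding triangles_def link_def by blast
    then have link_ne: "link E v \<noteq> {}" by blast
    have link_sub: "link E v \<subseteq> E" by (auto simp: link_def)
    have fin_link: "finite (link E v)" using link_sub fin by (rule finite_subset)
    have "\<forall>f\<in>link E v. card f = 2" by (auto simp: link_def)
    then obtain M C where M: "M \<subseteq> link E v" "pairwise (\<lambda>s t. s \<inter> t = {}) M" and C: "C \<subseteq> \<Union>(link E v)"
      "\<And>f. f \<in> link E v - M \<Longrightarrow> f \<inter> C \<noteq> {}" "card C \<le> card M"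
      using no_K4_subdivision_matching_cover[OF fin_link _ less.prems(2)] by metis
    have finM: "finite M" using M fin_link finite_subset by blast
    have finC: "finite C"
      using C(1) fin_link finite_Union_edges[OF fin_link \<open>\<forall>f\<in>link E v. card f = 2\<close>] finite_subset by blast
    \<comment> \<open>An empty matching would leave a nonempty link with an empty cover. That
      \<open>M\<close> is nonempty makes the edge set shrink.\<close>
    have M_ne: "M \<noteq> {}"
    proof
      assume "M = {}"
      then have "C = {}" using C(3) finC by simp
      then show False using C(2) link_ne \<open>M = {}\<close> by blast
    qed
    define X where "X = M \<union> (\<lambda>c. {v, c}) ` C"
    \<comment> \<open>The recursion avoids all edges of the packed triangles, which keeps its
      packing disjoint from them, but only \<open>X\<close> is charged to the cover.\<close>
    define E' where "E' = E - X - \<Union>(cone v ` M)"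
    have XE: "X \<subseteq> E" using M(1) link_sub C(1) by (force simp: X_def link_def)
    have "card X \<le> card M + card C"
      unfolding X_def using card_Un_le[of M] card_image_le[OF finC] by (meson add_left_mono order_trans)
    then have cardX: "card X \<le> 2 * card M" using C(3) by simp
    have E'E: "E' \<subset> E" using M_ne M(1) link_sub by (auto simp: E'_def X_def)
    have noK4: "\<not> has_K4_subdivision (link E' w)" for w
      using less.prems(2)[of w] has_K4_subdivision_mono[of "link E' w" "link E w"] link_mono[of E' E w] E'E
      by auto
    have finE': "finite E'" using E'E fin by (auto intro: finite_subset)
    obtain Y T where Y: "Y \<subseteq> E'" "triangles (E' - Y) = {}" and T: "T \<subseteq> triangles E'" "pairwise (\<lambda>s t. s \<inter> t = {}) T"
      and le: "card Y \<le> 2 * card T"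
      using less.hyps[OF psubset_card_mono[OF fin E'E] finE' noK4] by (elim exE conjE) (rule that)
    have coneE: "cone v ` M \<subseteq> triangles E"
      by (intro image_subsetI cone_triangle) (use M(1) in auto)
    have T_sub: "t \<subseteq> E'" if "t \<in> T" for t using T(1) triangle_subset that by (metis subsetD)
    have apart: "t \<inter> cone v m = {}" if "t \<in> T" "m \<in> M" for t m
      using T_sub[OF that(1)] that(2) by (auto simp: E'_def)
    have "T \<subseteq> Pow E'" using T_sub by blast
    then have finT: "finite T" using finE' by (meson finite_Pow_iff finite_subset)
    have inj: "inj_on (cone v) M"
    proof (rule inj_onI)
      fix m m' assume m: "m \<in> M" "m' \<in> M" "cone v m = cone v m'"
      show "m = m'"
      proof (rule ccontr)
        assume "m \<noteq> m'"
        then have "cone v m \<inter> cone v m' = {}"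
          using cone_disjoint[of m E v m'] M m(1,2) by (auto simp: pairwise_def)
        then show False using m(3) mem_cone[of m v] by auto
      qed
    qed
    have "T \<inter> cone v ` M = {}"
    proof (rule ccontr)
      assume "T \<inter> cone v ` M \<noteq> {}"
      then obtain m where m: "m \<in> M" "cone v m \<in> T" by blast
      then show False using apart[of "cone v m" m] mem_cone[of m v] by auto
    qed
    then have cardT: "card (T \<union> cone v ` M) = card T + card M"
      using finT finM inj by (simp add: card_Un_disjoint card_image)
    have "pairwise (\<lambda>s t. s \<inter> t = {}) (T \<union> cone v ` M)"
    proof -
      have "pairwise (\<lambda>s t. s \<inter> t = {}) (cone v ` M)"
        using M cone_disjoint[of _ E v] by (fastforce simp: pairwise_def)
      then show ?thesis
        using T(2) apart apart[THEN trans[OF Int_commute]] unfolding pairwise_def by (auto simp: ball_Un)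
    qed
    moreover have "T \<union> cone v ` M \<subseteq> triangles E"
      using T(1) triangles_mono[of E' E] E'E coneE by blast
    moreover have "triangles (E - (Y \<union> X)) = {}"
    proof (rule ccontr)
      assume "triangles (E - (Y \<union> X)) \<noteq> {}"
      then obtain t where t: "t \<in> triangles (E - (Y \<union> X))" by blast
      have tsub: "t \<subseteq> E - (Y \<union> X)" using triangle_subset[OF t] .
      \<comment> \<open>A surviving triangle must share an edge with a packed one, and that edge
        contains \<open>v\<close> because \<open>M\<close> is deleted. Its side opposite
        \<open>v\<close> is a link edge outside \<open>M\<close>, so \<open>C\<close> meets it and
        one of the sides at \<open>v\<close> lies in \<open>X\<close>.\<close>
      have "\<not> t \<subseteq> E' - Y"
      proof
        assume "t \<subseteq> E' - Y"
        then have "t \<in> triangles (E' - Y)" using t unfolding triangles_def by blast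
        then show False using Y by simp
      qed
      then obtain e m where e: "e \<in> t" "m \<in> M" "e \<in> cone v m" using tsub by (auto simp: E'_def)
      moreover have "e \<noteq> m" using e tsub by (auto simp: X_def)
      ultimately obtain x where x: "{v, x} \<in> t" "x \<in> m" by (auto simp: cone_def)
      have tE: "t \<in> triangles E" using t triangles_mono[of "E - (Y \<union> X)" E] by blast
      then obtain y where y: "{x, y} \<in> link E v" "{x, y} \<in> t" "{v, y} \<in> t"
        using triangle_at_vertex x by metis
      have "{x, y} \<notin> M" using y tsub by (auto simp: X_def)
      then have "{x, y} \<inter> C \<noteq> {}" using C(2) y by blast
      then have "{v, x} \<in> X \<or> {v, y} \<in> X" by (auto simp: X_def)
      then show False using x y tsub by blast
    qed
    moreover have "card (Y \<union> X) \<le> 2 * card (T \<union> cone v ` M)"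
      using card_Un_le[of Y X] le cardX cardT by linarith
    moreover have "Y \<union> X \<subseteq> E" using Y E'E XE by blast
    ultimately show ?thesis by blast
  qed
qed

theorem theorem3p8:
  fixes V :: "'a set" and E :: "'a set set"
  assumes "simple_graph V E"
    and "\<not> has_K5_subdivision V E"
  shows "triangle_cover_number E \<le> 2 * triangle_packing_number E"
proof -
  have "E \<subseteq> Pow V" using assms(1) by (auto simp: simple_graph_def)
  then have fin: "finite E" using assms(1) by (auto simp: simple_graph_def intro: finite_subset)
  have "\<not> has_K4_subdivision (link E v)" for v
    using K5_subdivision_of_link[OF assms(1), of v] assms(2) by auto
  then obtain Y T where Y: "Y \<subseteq> E" "triangles (E - Y) = {}" and T: "T \<subseteq> triangles E" "pairwise (\<lambda>s t. s \<inter> t = {}) T"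
    and le: "card Y \<le> 2 * card T"
    using triangle_packing_and_cover[OF fin] by blast
  have "finite {Y. Y \<subseteq> E \<and> triangles (E - Y) = {}}" using fin by auto
  then have "triangle_cover_number E \<le> card Y"
    unfolding triangle_cover_number_def using Y by (intro Min_le) auto
  moreover have "triangles E \<subseteq> Pow E" using triangle_subset by blast
  then have "finite (triangles E)" using fin by (meson finite_Pow_iff finite_subset)
  then have "finite {T. T \<subseteq> triangles E \<and> pairwise (\<lambda>s t. s \<inter> t = {}) T}" by auto
  then have "card T \<le> triangle_packing_number E"
    unfolding triangle_packing_number_def using T
    by (intro Max_ge) auto
  ultimately show ?thesis using le by linarith
qed

end
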